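(* For every ForNo term $T$ and every total function $f:\Sigma^*\to\Sigma^*$ (with $\Sigma$ a finite alphabet), if $T$ computes $f$ (for some choice of registers $\mathrm{in},\mathrm{out}$ and some encoding $\langle\!\langle\cdot\rangle\!\rangle$), then $f$ is in FPTIME.
   Context: Stacks and states: stacks are finite lists of natural numbers, $[\,]$ empty, $n::t$ has top $n$; $|s|$ is the length. Registers come from a countable set. A store $\phi$ maps every register to a stack; $\varnothing$ maps every register to $[\,]$, and $\phi[x\to s]$ updates $x$. A state is a pair $(\phi,c)$ with $c\in\mathbb N$ an error counter; $\omega(x)$ denotes $\phi(x)$ for $\omega=(\phi,c)$. Raw terms (start symbol $T$, $n\in\mathbb N$, $x,y$ registers): $T ::= A \mid T;T \mid \mathtt{IF}\ x = n\ \{T\} \mid \mathtt{NORMAL}\ N\ \{S\}$; $N ::= y \mid y,N$; $A ::= \mathtt{SKIP}\mid \mathtt{PUSH}[n]\ x \mid \mathtt{POP}[n]\ x$; $S ::= A \mid S;S \mid \mathtt{IF}\ x=n\ \{S\} \mid \mathtt{FOR}\ x\ C \mid \mathtt{ROF}\ x\ C$; $C ::= \{S\} \mid \{S\}\ C$. $\mathtt{PUSH}/\mathtt{POP}$ "write" their register; $x$ "leads" $\mathtt{IF}\ x=n$, $\mathtt{FOR}\ x$, $\mathtt{ROF}\ x$. ForNo is the set of raw terms generated from $T$ such that: (i) if $x$ leads a selection or iteration with bodies $S_1,\dots,S_k$, no atomic term in these bodies writes $x$; (ii) the registers listed in $N$ of $\mathtt{NORMAL}\ N\ \{S\}$ are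 not written in $S$ and are the only registers that can lead iterations in $S$. Semantics (big-step, judgments $\langle T,\omega\rangle\Downarrow\omega'$): $\mathtt{SKIP}$ leaves the state unchanged; $T;U$ runs $T$ then $U$; $\mathtt{PUSH}[n]\ x$ on $(\phi,c)$ yields $(\phi[x\to s],c')$ where $\mathrm{push}_n(\phi(x),c)=(s,c')$, and $\mathtt{POP}[n]\ x$ likewise with $\mathrm{pop}_n$; here $\mathrm{push}_n,\mathrm{pop}_n:\mathcal S\times\mathbb N\to\mathcal S\times\mathbb N$ are fixed, mutually inverse total functions with $\mathrm{push}_n(s,0)=(n::s,0)$, $\mathrm{pop}_n(n::s,0)=(s,0)$, and if the top of $s$ is not $n$ then $\mathrm{pop}_n(s,0)=(s,1)$ (the counter records failed pops). $\mathtt{IF}\ x=n\ \{P\}$ runs $P$ if $\omega(x)$ is nonempty with top $n$, otherwise does nothing. $\mathtt{FOR}\ x\ \{P_0\}\dots\{P_k\}$ takes the stack $\omega(x)$ at entry and, for each of its elements $i$ in order from the top down, runs $P_{\min(i,k)}$ (so exactly $|\omega(x)|$ steps); $\mathtt{ROF}$ does the same on the reversal of $\omega(x)$. $\mathtt{NORMAL}\ N\ \{T\}$ runs $T$. Encoding and computation: an encoding is a bijection $\langle\!\langle\cdot\rangle\!\rangle:\Sigma\to\{0,\dots,|\Sigma|-1\}$, extended to strings by $\langle\!\langle\epsilon\rangle\!\rangle=[\,]$, $\langle\!\langle a\cdot x\rangle\!\rangle=\langle\!\langle a\rangle\!\rangle::\langle\!\langle x\rangle\!\rangle$. A term $T$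 with registers $\mathrm{in},\mathrm{out}$ computes a total $f:\Sigma^*\to\Sigma^*$ if for every $x\in\Sigma^*$ there is $\phi$ with $\langle T,(\varnothing[\mathrm{in}\to\langle\!\langle x\rangle\!\rangle],0)\rangle\Downarrow(\phi,0)$ and $\phi(\mathrm{out})=\langle\!\langle f(x)\rangle\!\rangle$. FPTIME: the class of total functions $\Sigma^*\to\Sigma^*$ computable by a deterministic Turing machine that halts within $p(|w|)$ steps on every input $w$, for some polynomial $p$.
   Formalization: push_n and pop_n, given only at counter 0, are fixed for c>0 (for arbitrary inverse pairs the claim fails): the stack is unchanged; if its top is n both are the identity, otherwise pop_n adds 1 to c and push_n subtracts 1. *)

theory Defs
  imports Main "HOL-Library.Countable" "HOL-Library.FuncSet" "HOL-Computational_Algebra.Polynomial"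
begin

type_synonym stack = "nat list"
type_synonym 'r store = "'r \<Rightarrow> stack"
type_synonym 'r state = "'r store \<times> nat"

definition empty_store :: "'r store" where
  "empty_store = (\<lambda>_. [])"

definition top_is :: "nat \<Rightarrow> stack \<Rightarrow> bool" where
  "top_is n s \<longleftrightarrow> (\<exists>t. s = n # t)"

text \<open>
  On counter 0 both operations are forced: \<open>push\<close> pushes, \<open>pop\<close> pops a matching top and
  otherwise sets the counter to 1. With a nonzero counter the stack is left alone; \<open>pop n\<close>
  counts a further failure when the top is not \<open>n\<close>, and \<open>push n\<close> undoes it. When the top is \<open>n\<close>
  and the counter is nonzero, both are the identity: simply incrementing there would leave
  \<open>(n # s, 1)\<close> outside the range of \<open>pop n\<close>, which then could not have a two-sided inverse.
\<close>

fun push :: "nat \<Rightarrow> stack \<times> nat \<Rightarrow> stack \<times> nat" where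
  "push n (s, c) =
    (if c = 0 then (n # s, 0) else if top_is n s then (s, c) else (s, c - 1))"

fun pop :: "nat \<Rightarrow> stack \<times> nat \<Rightarrow> stack \<times> nat" where
  "pop n (s, c) =
    (if top_is n s then (if c = 0 then (tl s, 0) else (s, c)) else (s, c + 1))"

lemma push_zero: "push n (s, 0) = (n # s, 0)"
  by simp

lemma pop_zero_match: "pop n (n # s, 0) = (s, 0)"
  by (simp add: top_is_def)

lemma pop_zero_fail: "\<not> top_is n s \<Longrightarrow> pop n (s, 0) = (s, 1)"
  by simp

lemma pop_push: "pop n (push n z) = z"
  by (cases z) (auto simp: top_is_def)

lemma push_pop: "push n (pop n z) = z"
  by (cases z) (auto simp: top_is_def)

datatype 'r atom = Skip | Push nat 'r | Pop nat 'r

text \<open>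
  The nonempty sequences of the grammar (bodies of an iteration, registers of a \<open>Normal\<close>)
  are given by their first element and the list of the remaining ones.
\<close>

datatype 'r stm =
    SAtom "'r atom"
  | SSeq "'r stm" "'r stm"
  | SIf 'r nat "'r stm"
  | SFor 'r "'r stm" "'r stm list"
  | SRof 'r "'r stm" "'r stm list"

datatype 'r trm =
    TAtom "'r atom"
  | TSeq "'r trm" "'r trm"
  | TIf 'r nat "'r trm"
  | Normal 'r "'r list" "'r stm"

fun writes_atom :: "'r atom \<Rightarrow> 'r set" where
  "writes_atom Skip = {}"
| "writes_atom (Push n x) = {x}"
| "writes_atom (Pop n x) = {x}"

fun writes_stm :: "'r stm \<Rightarrow> 'r set" where
  "writes_stm (SAtom a) = writes_atom a"
| "writes_stm (SSeq P Q) = writes_stm P \<union> writes_stm Q"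
| "writes_stm (SIf x n P) = writes_stm P"
| "writes_stm (SFor x P Ps) = writes_stm P \<union> (\<Union>Q\<in>set Ps. writes_stm Q)"
| "writes_stm (SRof x P Ps) = writes_stm P \<union> (\<Union>Q\<in>set Ps. writes_stm Q)"

fun writes_trm :: "'r trm \<Rightarrow> 'r set" where
  "writes_trm (TAtom a) = writes_atom a"
| "writes_trm (TSeq P Q) = writes_trm P \<union> writes_trm Q"
| "writes_trm (TIf x n P) = writes_trm P"
| "writes_trm (Normal y ys P) = writes_stm P"

fun iteration_leaders :: "'r stm \<Rightarrow> 'r set" where
  "iteration_leaders (SAtom a) = {}"
| "iteration_leaders (SSeq P Q) = iteration_leaders P \<union> iteration_leaders Q"
| "iteration_leaders (SIf x n P) = iteration_leaders P"
| "iteration_leaders (SFor x P Ps) =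
    {x} \<union> iteration_leaders P \<union> (\<Union>Q\<in>set Ps. iteration_leaders Q)"
| "iteration_leaders (SRof x P Ps) =
    {x} \<union> iteration_leaders P \<union> (\<Union>Q\<in>set Ps. iteration_leaders Q)"

fun leaders_unwritten_stm :: "'r stm \<Rightarrow> bool" where
  "leaders_unwritten_stm (SAtom a) \<longleftrightarrow> True"
| "leaders_unwritten_stm (SSeq P Q) \<longleftrightarrow> leaders_unwritten_stm P \<and> leaders_unwritten_stm Q"
| "leaders_unwritten_stm (SIf x n P) \<longleftrightarrow> x \<notin> writes_stm P \<and> leaders_unwritten_stm P"
| "leaders_unwritten_stm (SFor x P Ps) \<longleftrightarrow>
    x \<notin> writes_stm P \<and> leaders_unwritten_stm P \<and>
    (\<forall>Q\<in>set Ps. x \<notin> writes_stm Q \<and> leaders_unwritten_stm Q)"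
| "leaders_unwritten_stm (SRof x P Ps) \<longleftrightarrow>
    x \<notin> writes_stm P \<and> leaders_unwritten_stm P \<and>
    (\<forall>Q\<in>set Ps. x \<notin> writes_stm Q \<and> leaders_unwritten_stm Q)"

fun leaders_unwritten :: "'r trm \<Rightarrow> bool" where
  "leaders_unwritten (TAtom a) \<longleftrightarrow> True"
| "leaders_unwritten (TSeq P Q) \<longleftrightarrow> leaders_unwritten P \<and> leaders_unwritten Q"
| "leaders_unwritten (TIf x n P) \<longleftrightarrow> x \<notin> writes_trm P \<and> leaders_unwritten P"
| "leaders_unwritten (Normal y ys P) \<longleftrightarrow> leaders_unwritten_stm P"

fun normals_ok :: "'r trm \<Rightarrow> bool" where
  "normals_ok (TAtom a) \<longleftrightarrow> True"
| "normals_ok (TSeq P Q) \<longleftrightarrow> normals_ok P \<and> normals_ok Q"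
| "normals_ok (TIf x n P) \<longleftrightarrow> normals_ok P"
| "normals_ok (Normal y ys P) \<longleftrightarrow>
    set (y # ys) \<inter> writes_stm P = {} \<and> iteration_leaders P \<subseteq> set (y # ys)"

definition ForNo :: "'r trm set" where
  "ForNo = {T. leaders_unwritten T \<and> normals_ok T}"

fun exec_atom :: "'r atom \<Rightarrow> 'r state \<Rightarrow> 'r state" where
  "exec_atom Skip (\<phi>, c) = (\<phi>, c)"
| "exec_atom (Push n x) (\<phi>, c) = (let (s, c') = push n (\<phi> x, c) in (\<phi>(x := s), c'))"
| "exec_atom (Pop n x) (\<phi>, c) = (let (s, c') = pop n (\<phi> x, c) in (\<phi>(x := s), c'))"

text \<open>
  \<open>exec_iter Ps is \<omega> \<omega>'\<close> runs, for the successive elements \<open>i\<close> of \<open>is\<close>, the body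
  with index \<open>min i k\<close>, where \<open>Ps\<close> consists of the bodies \<open>0, \<dots>, k\<close>.
\<close>

inductive exec_stm :: "'r stm \<Rightarrow> 'r state \<Rightarrow> 'r state \<Rightarrow> bool"
  and exec_iter :: "'r stm list \<Rightarrow> nat list \<Rightarrow> 'r state \<Rightarrow> 'r state \<Rightarrow> bool"
where
  exec_SAtom: "exec_stm (SAtom a) \<omega> (exec_atom a \<omega>)"
| exec_SSeq: "exec_stm P \<omega> \<omega>' \<Longrightarrow> exec_stm Q \<omega>' \<omega>'' \<Longrightarrow> exec_stm (SSeq P Q) \<omega> \<omega>''"
| exec_SIf_true: "top_is n (fst \<omega> x) \<Longrightarrow> exec_stm P \<omega> \<omega>' \<Longrightarrow> exec_stm (SIf x n P) \<omega> \<omega>'"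
| exec_SIf_false: "\<not> top_is n (fst \<omega> x) \<Longrightarrow> exec_stm (SIf x n P) \<omega> \<omega>"
| exec_SFor: "exec_iter (P # Ps) (fst \<omega> x) \<omega> \<omega>' \<Longrightarrow> exec_stm (SFor x P Ps) \<omega> \<omega>'"
| exec_SRof: "exec_iter (P # Ps) (rev (fst \<omega> x)) \<omega> \<omega>' \<Longrightarrow> exec_stm (SRof x P Ps) \<omega> \<omega>'"
| exec_iter_Nil: "exec_iter Ps [] \<omega> \<omega>"
| exec_iter_Cons: "exec_stm (Ps ! min i (length Ps - 1)) \<omega> \<omega>' \<Longrightarrow> exec_iter Ps is \<omega>' \<omega>'' \<Longrightarrow>
    exec_iter Ps (i # is) \<omega> \<omega>''"

inductive exec :: "'r trm \<Rightarrow> 'r state \<Rightarrow> 'r state \<Rightarrow> bool" where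
  exec_TAtom: "exec (TAtom a) \<omega> (exec_atom a \<omega>)"
| exec_TSeq: "exec P \<omega> \<omega>' \<Longrightarrow> exec Q \<omega>' \<omega>'' \<Longrightarrow> exec (TSeq P Q) \<omega> \<omega>''"
| exec_TIf_true: "top_is n (fst \<omega> x) \<Longrightarrow> exec P \<omega> \<omega>' \<Longrightarrow> exec (TIf x n P) \<omega> \<omega>'"
| exec_TIf_false: "\<not> top_is n (fst \<omega> x) \<Longrightarrow> exec (TIf x n P) \<omega> \<omega>"
| exec_Normal: "exec_stm P \<omega> \<omega>' \<Longrightarrow> exec (Normal y ys P) \<omega> \<omega>'"

definition encoding :: "'a set \<Rightarrow> ('a \<Rightarrow> nat) \<Rightarrow> bool" where
  "encoding \<Sigma> enc \<longleftrightarrow> bij_betw enc \<Sigma> {..<card \<Sigma>}"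

definition computes ::
  "'r trm \<Rightarrow> 'r \<Rightarrow> 'r \<Rightarrow> 'a set \<Rightarrow> ('a \<Rightarrow> nat) \<Rightarrow> ('a list \<Rightarrow> 'a list) \<Rightarrow> bool" where
  "computes T rin rout \<Sigma> enc f \<longleftrightarrow>
    (\<forall>w\<in>lists \<Sigma>. \<exists>\<phi>. exec T (empty_store(rin := map enc w), 0) (\<phi>, 0) \<and>
      \<phi> rout = map enc (f w))"

datatype 'a symbol = Blank | Letter 'a | Mark nat

datatype move = MoveLeft | Stay | MoveRight

record 'a tm =
  tm_tapes :: nat
  tm_states :: "nat set"
  tm_alphabet :: "'a symbol set"
  tm_start :: nat
  tm_halting :: "nat set"
  tm_delta :: "nat \<Rightarrow> 'a symbol list \<Rightarrow> nat \<times> ('a symbol \<times> move) list"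

definition turing_machine :: "'a set \<Rightarrow> 'a tm \<Rightarrow> bool" where
  "turing_machine \<Sigma> M \<longleftrightarrow>
    tm_tapes M \<ge> 1 \<and>
    finite (tm_states M) \<and> tm_start M \<in> tm_states M \<and> tm_halting M \<subseteq> tm_states M \<and>
    finite (tm_alphabet M) \<and> Blank \<in> tm_alphabet M \<and> Letter ` \<Sigma> \<subseteq> tm_alphabet M \<and>
    (\<forall>q\<in>tm_states M - tm_halting M. \<forall>gs\<in>lists (tm_alphabet M). length gs = tm_tapes M \<longrightarrow>
      (case tm_delta M q gs of (q', acts) \<Rightarrow>
        q' \<in> tm_states M \<and> length acts = tm_tapes M \<and> fst ` set acts \<subseteq> tm_alphabet M))"

text \<open>A tape is infinite in both directions and is paired with its head position.\<close>

type_synonym 'a tape = "(int \<Rightarrow> 'a symbol) \<times> int"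
type_synonym 'a config = "nat \<times> 'a tape list"

fun head_move :: "move \<Rightarrow> int \<Rightarrow> int" where
  "head_move MoveLeft i = i - 1"
| "head_move Stay i = i"
| "head_move MoveRight i = i + 1"

fun tape_read :: "'a tape \<Rightarrow> 'a symbol" where
  "tape_read (t, i) = t i"

fun tape_act :: "'a symbol \<times> move \<Rightarrow> 'a tape \<Rightarrow> 'a tape" where
  "tape_act (g, m) (t, i) = (t(i := g), head_move m i)"

fun tm_step :: "'a tm \<Rightarrow> 'a config \<Rightarrow> 'a config" where
  "tm_step M (q, ts) =
    (if q \<in> tm_halting M then (q, ts)
     else case tm_delta M q (map tape_read ts) of (q', acts) \<Rightarrow> (q', map2 tape_act acts ts))"

definition word_on_tape :: "'a list \<Rightarrow> int \<Rightarrow> 'a symbol" where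
  "word_on_tape w i = (if 0 \<le> i \<and> nat i < length w then Letter (w ! nat i) else Blank)"

definition tm_init :: "'a tm \<Rightarrow> 'a list \<Rightarrow> 'a config" where
  "tm_init M w =
    (tm_start M, (word_on_tape w, 0) # replicate (tm_tapes M - 1) (word_on_tape [], 0))"

definition tm_outputs_within :: "'a tm \<Rightarrow> 'a list \<Rightarrow> nat \<Rightarrow> 'a list \<Rightarrow> bool" where
  "tm_outputs_within M w n v \<longleftrightarrow>
    (\<exists>t\<le>n. case (tm_step M ^^ t) (tm_init M w) of (q, ts) \<Rightarrow>
      q \<in> tm_halting M \<and> fst (last ts) = word_on_tape v)"

definition FPTIME :: "'a set \<Rightarrow> ('a list \<Rightarrow> 'a list) set" where
  "FPTIME \<Sigma> = {f \<in> lists \<Sigma> \<rightarrow> lists \<Sigma>.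
    \<exists>M (p :: nat poly). turing_machine \<Sigma> M \<and>
      (\<forall>w\<in>lists \<Sigma>. tm_outputs_within M w (poly p (length w)) (f w))}"

end

theory Submission
  imports Defs
begin

text \<open>
  Inside a \<open>Normal\<close> block no loop leader is ever written, so all loop lengths are fixed on entry
  and the running time is a polynomial in the lengths of the leaders. A stack grows by at most one
  per step; hence the output of a block is polynomially bounded in its input, and polynomial bounds
  compose along sequences. The term is compiled to a structured program over finitely many stacks
  (registers, the error counter in unary, and one auxiliary stack per loop depth), which a
  multi-tape Turing machine executes with one tape per stack. The heads stand on the tops of the
  stacks and stacks grow to the left, so the input tape already is the stack that encodes the
  input word; the result is copied to a separate last tape from left to right.
\<close>

section \<open>Structured programs over several stacks\<close>

text \<open>
  \<open>CPushW\<close> and \<open>CCopyW\<close> are the second halves of \<open>CPush\<close> and \<open>CCopy\<close>: a Turing machine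
  first has to move its head off the top of the stack before it can write. They only occur in
  control states and have no big-step semantics.
\<close>

datatype 'k com =
    CNop
  | CPush 'k nat
  | CPushW 'k nat
  | CPop 'k
  | CCopy 'k 'k
  | CCopyW 'k 'k
  | CEmit 'k
  | CSeq "'k com" "'k com"
  | CIf 'k nat "'k com" "'k com"
  | CWhile 'k "'k com"

instance com :: (countable) countable
  by countable_datatype

inductive run :: "'k com \<Rightarrow> ('k \<Rightarrow> stack) \<times> nat list \<Rightarrow> nat \<Rightarrow> ('k \<Rightarrow> stack) \<times> nat list \<Rightarrow> bool" where
  run_Nop: "run CNop \<sigma> (Suc 0) \<sigma>"
| run_Push: "run (CPush k n) (\<sigma>, v) 2 (\<sigma>(k := n # \<sigma> k), v)"
| run_Pop: "run (CPop k) (\<sigma>, v) (Suc 0) (\<sigma>(k := tl (\<sigma> k)), v)"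
| run_Copy: "\<sigma> j = a # s \<Longrightarrow> run (CCopy j k) (\<sigma>, v) 2 (\<sigma>(k := a # \<sigma> k), v)"
| run_Emit: "\<sigma> j = a # s \<Longrightarrow> run (CEmit j) (\<sigma>, v) (Suc 0) (\<sigma>, v @ [a])"
| run_Seq: "run a \<sigma> t \<sigma>' \<Longrightarrow> run b \<sigma>' u \<sigma>'' \<Longrightarrow> run (CSeq a b) \<sigma> (Suc (t + u)) \<sigma>''"
| run_If_true: "top_is n (fst \<sigma> k) \<Longrightarrow> run a \<sigma> t \<sigma>' \<Longrightarrow> run (CIf k n a b) \<sigma> (Suc t) \<sigma>'"
| run_If_false: "\<not> top_is n (fst \<sigma> k) \<Longrightarrow> run b \<sigma> t \<sigma>' \<Longrightarrow> run (CIf k n a b) \<sigma> (Suc t) \<sigma>'"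
| run_While_true: "fst \<sigma> k \<noteq> [] \<Longrightarrow> run a \<sigma> t \<sigma>' \<Longrightarrow> run (CWhile k a) \<sigma>' u \<sigma>'' \<Longrightarrow>
    run (CWhile k a) \<sigma> (Suc (t + u)) \<sigma>''"
| run_While_false: "fst \<sigma> k = [] \<Longrightarrow> run (CWhile k a) \<sigma> (Suc 0) \<sigma>"

text \<open>Each basic command takes at least one step and adds at most one element to a given
  stack. Time bounds thus become size bounds, both for the input of a following block and for the
  output.\<close>

lemma run_length_le: "run c \<sigma> t \<sigma>' \<Longrightarrow> length (fst \<sigma>' k) \<le> length (fst \<sigma> k) + t"
  by (induction rule: run.induct) auto

fun indices :: "'k com \<Rightarrow> 'k set" where
  "indices CNop = {}"
| "indices (CPush k n) = {k}"
| "indices (CPushW k n) = {k}"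
| "indices (CPop k) = {k}"
| "indices (CCopy j k) = {j, k}"
| "indices (CCopyW j k) = {j, k}"
| "indices (CEmit j) = {j}"
| "indices (CSeq a b) = indices a \<union> indices b"
| "indices (CIf k n a b) = {k} \<union> indices a \<union> indices b"
| "indices (CWhile k a) = {k} \<union> indices a"

lemma finite_indices: "finite (indices c)"
  by (induction c) auto

text \<open>These are the numbers whose symbols a program can write afresh. A test only compares
  with its number, and copies reuse symbols that are already on the tapes.\<close>

fun constants :: "'k com \<Rightarrow> nat set" where
  "constants (CPush k n) = {n}"
| "constants (CPushW k n) = {n}"
| "constants (CSeq a b) = constants a \<union> constants b"
| "constants (CIf k n a b) = constants a \<union> constants b"
| "constants (CWhile k a) = constants a"
| "constants _ = {}"

lemma finite_constants: "finite (constants c)"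
  by (induction c) auto

text \<open>The machine moves the target head before it reads the source. On a single tape it would
  then read the blank cell just entered instead of the top.\<close>

fun copies_proper :: "'k com \<Rightarrow> bool" where
  "copies_proper (CCopy j k) \<longleftrightarrow> j \<noteq> k"
| "copies_proper (CSeq a b) \<longleftrightarrow> copies_proper a \<and> copies_proper b"
| "copies_proper (CIf k n a b) \<longleftrightarrow> copies_proper a \<and> copies_proper b"
| "copies_proper (CWhile k a) \<longleftrightarrow> copies_proper a"
| "copies_proper _ \<longleftrightarrow> True"

section \<open>Turing machines for stack programs\<close>

text \<open>
  A control state is the list of commands still to be executed. Since there is no recursion,
  only finitely many such lists are reachable from a command.
\<close>

fun control :: "'k com \<Rightarrow> 'k com list set" where
  "control (CPush k n) = {[CPush k n], [CPushW k n], []}"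
| "control (CCopy j k) = {[CCopy j k], [CCopyW j k], []}"
| "control (CSeq a b) = {[CSeq a b]} \<union> (\<lambda>p. p @ [b]) ` control a \<union> control b"
| "control (CIf k n a b) = {[CIf k n a b]} \<union> control a \<union> control b"
| "control (CWhile k a) = {[CWhile k a], []} \<union> (\<lambda>p. p @ [CWhile k a]) ` control a"
| "control c = {[c], []}"

lemma finite_control: "finite (control c)"
  by (induction c) auto

lemma Nil_in_control: "[] \<in> control c"
  by (induction c) auto

lemma single_in_control: "[c] \<in> control c"
  by (cases c) auto

lemma constants_control: "p \<in> control c \<Longrightarrow> d \<in> set p \<Longrightarrow> constants d \<subseteq> constants c"
  by (induction c arbitrary: p) (auto, blast+)

lemma indices_control: "p \<in> control c \<Longrightarrow> d \<in> set p \<Longrightarrow> indices d \<subseteq> indices c"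
  by (induction c arbitrary: p) (auto, blast+)

definition idle :: "'a symbol list \<Rightarrow> ('a symbol \<times> move) list" where
  "idle gs = map (\<lambda>g. (g, Stay)) gs"

lemma length_idle [simp]: "length (idle gs) = length gs"
  by (simp add: idle_def)

lemma tape_act_read [simp]: "tape_act (tape_read t, Stay) t = t"
  by (cases t) simp

lemma map2_tape_act_idle: "map2 tape_act (idle (map tape_read ts)) ts = ts"
  by (rule nth_equalityI) (auto simp: idle_def)

lemma map2_tape_act_update:
  "map2 tape_act ((idle (map tape_read ts))[k := a]) ts = ts[k := tape_act a (ts ! k)]"
proof (rule nth_equalityI)
  fix i
  assume "i < length (map2 tape_act ((idle (map tape_read ts))[k := a]) ts)"
  then show "map2 tape_act ((idle (map tape_read ts))[k := a]) ts ! i =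
      ts[k := tape_act a (ts ! k)] ! i"
    by (cases "i = k") (auto simp: idle_def)
qed simp

lemma funpow_step: "F x = y \<Longrightarrow> (F ^^ t) y = z \<Longrightarrow> (F ^^ Suc t) x = z"
  by (simp add: funpow_swap1)

lemma funpow_trans: "(F ^^ t) x = y \<Longrightarrow> (F ^^ u) y = z \<Longrightarrow> (F ^^ (t + u)) x = z"
  by (metis add.commute comp_apply funpow_add)

text \<open>The map \<open>ix\<close> numbers all stacks, of which there may be infinitely many, but
  only those with \<open>ix k < N\<close> get a tape; tape \<open>N\<close>, the last one, is
  reserved for the output. Since \<open>h\<close> never yields \<open>Blank\<close>, a blank under
  the head means an empty stack.\<close>

locale stack_tm =
  fixes N :: nat and ix :: "'k::countable \<Rightarrow> nat" and h :: "nat \<Rightarrow> 'a symbol"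
  assumes inj_ix: "inj ix" and inj_h: "inj h" and h_not_Blank: "h n \<noteq> Blank"
begin

text \<open>A tape action writes before it moves. A push therefore first rewrites the symbol just
  read and moves left, and fills the new cell one step later. A pop erases and moves right, which
  keeps the cells left of the head blank.\<close>

fun next_control :: "'k com list \<Rightarrow> 'a symbol list \<Rightarrow> 'k com list \<times> ('a symbol \<times> move) list" where
  "next_control [] gs = ([], idle gs)"
| "next_control (CNop # cs) gs = (cs, idle gs)"
| "next_control (CPush k n # cs) gs = (CPushW k n # cs, (idle gs)[ix k := (gs ! ix k, MoveLeft)])"
| "next_control (CPushW k n # cs) gs = (cs, (idle gs)[ix k := (h n, Stay)])"
| "next_control (CPop k # cs) gs = (cs, (idle gs)[ix k := (Blank, MoveRight)])"
| "next_control (CCopy j k # cs) gs = (CCopyW j k # cs, (idle gs)[ix k := (gs ! ix k, MoveLeft)])"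
| "next_control (CCopyW j k # cs) gs = (cs, (idle gs)[ix k := (gs ! ix j, Stay)])"
| "next_control (CEmit j # cs) gs = (cs, (idle gs)[N := (gs ! ix j, MoveRight)])"
| "next_control (CSeq a b # cs) gs = (a # b # cs, idle gs)"
| "next_control (CIf k n a b # cs) gs = ((if gs ! ix k = h n then a else b) # cs, idle gs)"
| "next_control (CWhile k a # cs) gs =
    (if gs ! ix k = Blank then cs else a # CWhile k a # cs, idle gs)"

definition machine :: "'a set \<Rightarrow> 'k com \<Rightarrow> 'a tm" where
  "machine \<Sigma> c = \<lparr>tm_tapes = Suc N, tm_states = to_nat ` control c,
     tm_alphabet = insert Blank (Letter ` \<Sigma> \<union> h ` constants c),
     tm_start = to_nat [c], tm_halting = {to_nat ([] :: 'k com list)},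
     tm_delta = (\<lambda>q gs. case next_control (from_nat q) gs of (cs, acts) \<Rightarrow> (to_nat cs, acts))\<rparr>"

text \<open>Only the first command is inspected; the pending ones are carried along.\<close>

lemma next_control_append:
  "p \<noteq> [] \<Longrightarrow> next_control (p @ cs) gs =
    (case next_control p gs of (p', acts) \<Rightarrow> (p' @ cs, acts))"
  by (cases "(p, gs)" rule: next_control.cases) auto

lemma control_closed:
  "p \<in> control c \<Longrightarrow> p \<noteq> [] \<Longrightarrow> fst (next_control p gs) \<in> control c"
proof (induction c arbitrary: p)
  case (CSeq a b)
  then consider "p = [CSeq a b]" | q where "p = q @ [b]" "q \<in> control a" | "p \<in> control b"
    by auto
  then show ?case
  proof cases
    case 1
    then show ?thesis using single_in_control[of a] by auto
  next
    case (2 q)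
    then show ?thesis
      using CSeq.IH(1)[of q] CSeq.IH(2)[of "[b]"] single_in_control[of b]
      by (cases "q = []") (auto simp: next_control_append split: prod.splits)
  qed (use CSeq in auto)
next
  case (CIf k n a b)
  then show ?case
    using single_in_control[of a] single_in_control[of b] by auto
next
  case (CWhile k a)
  \<comment> \<open>The case \<open>q = []\<close> is the first alternative: a finished body leaves
    just the loop command, so that repetition creates no new control lists.\<close>
  then consider "p = [CWhile k a]" | q where "p = q @ [CWhile k a]" "q \<in> control a" "q \<noteq> []"
    by auto
  then show ?case
  proof cases
    case 1
    then show ?thesis using single_in_control[of a] by auto
  next
    case (2 q)
    then show ?thesis
      using CWhile.IH[of q] by (auto simp: next_control_append split: prod.splits)
  qed
qed auto

text \<open>A command writes only symbols just read, blanks, and \<open>h n\<close> for its own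
  constants \<open>n\<close>.\<close>

lemma next_control_acts:
  assumes "cs \<noteq> []" "set gs \<subseteq> \<Gamma>" "Blank \<in> \<Gamma>" "length gs = Suc N"
    and "h ` constants (hd cs) \<subseteq> \<Gamma>" "ix ` indices (hd cs) \<subseteq> {..<N}"
  shows "length (snd (next_control cs gs)) = Suc N" "fst ` set (snd (next_control cs gs)) \<subseteq> \<Gamma>"
proof -
  have upd: "fst ` set ((idle gs)[k := (g, m)]) \<subseteq> \<Gamma>" if "g \<in> \<Gamma>" for k g m
  proof -
    have "fst ` set ((idle gs)[k := (g, m)]) \<subseteq> fst ` insert (g, m) (set (idle gs))"
      by (intro image_mono set_update_subset_insert)
    also have "\<dots> \<subseteq> \<Gamma>"
      using that assms(2) by (auto simp: idle_def)
    finally show ?thesis .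
  qed
  have nth: "gs ! ix k \<in> \<Gamma>" if "k \<in> indices (hd cs)" for k
    using that assms by (metis image_subset_iff lessThan_iff less_SucI nth_mem subsetD)
  have "fst ` set (idle gs) \<subseteq> \<Gamma>"
    using assms(2) by (auto simp: idle_def)
  then show "fst ` set (snd (next_control cs gs)) \<subseteq> \<Gamma>"
    using assms(1,3,5) nth
    by (cases "(cs, gs)" rule: next_control.cases) (auto intro!: upd simp: image_subset_iff[symmetric])
  show "length (snd (next_control cs gs)) = Suc N"
    using assms(1,4) by (cases "(cs, gs)" rule: next_control.cases) auto
qed

lemma turing_machine_machine:
  assumes "finite \<Sigma>" "ix ` indices c \<subseteq> {..<N}"
  shows "turing_machine \<Sigma> (machine \<Sigma> c)"
  unfolding turing_machine_def
proof (intro conjI ballI impI)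
  fix q gs
  assume q: "q \<in> tm_states (machine \<Sigma> c) - tm_halting (machine \<Sigma> c)"
    and gs: "gs \<in> lists (tm_alphabet (machine \<Sigma> c))" "length gs = tm_tapes (machine \<Sigma> c)"
  then obtain p where p: "q = to_nat p" "p \<in> control c" "p \<noteq> []"
    by (auto simp: machine_def)
  then have hd: "constants (hd p) \<subseteq> constants c" "indices (hd p) \<subseteq> indices c"
    using constants_control indices_control hd_in_set by metis+
  have "length (snd (next_control p gs)) = Suc N"
    "fst ` set (snd (next_control p gs)) \<subseteq> tm_alphabet (machine \<Sigma> c)"
    by (rule next_control_acts[of p gs "tm_alphabet (machine \<Sigma> c)"]; 
      use p gs hd assms in \<open>auto simp: machine_def\<close>)+
  then show "case tm_delta (machine \<Sigma> c) q gs of (q', acts) \<Rightarrow>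
      q' \<in> tm_states (machine \<Sigma> c) \<and> length acts = tm_tapes (machine \<Sigma> c) \<and>
      fst ` set acts \<subseteq> tm_alphabet (machine \<Sigma> c)"
    using control_closed[OF p(2,3), of gs]
    by (cases "next_control p gs") (simp add: machine_def p(1))
qed (use assms(1) in \<open>auto simp: machine_def finite_control single_in_control Nil_in_control finite_constants\<close>)

section \<open>Stacks and output as tape contents\<close>

definition stack_tape :: "stack \<Rightarrow> int \<Rightarrow> 'a tape" where
  "stack_tape s i = (\<lambda>j. if i \<le> j \<and> nat (j - i) < length s then h (s ! nat (j - i)) else Blank, i)"

text \<open>The output starts at cell 0 and grows to the right, as \<open>word_on_tape\<close>
  demands; the head waits on the first free cell.\<close>

definition output_tape :: "nat list \<Rightarrow> 'a tape" where
  "output_tape v =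
    (\<lambda>j. if 0 \<le> j \<and> nat j < length v then h (v ! nat j) else Blank, int (length v))"

lemma tape_read_stack: "tape_read (stack_tape s i) = (case s of [] \<Rightarrow> Blank | n # _ \<Rightarrow> h n)"
  by (auto simp: stack_tape_def split: list.splits)

lemma stack_tape_push:
  "tape_act (h n, Stay) (tape_act (tape_read (stack_tape s i), MoveLeft) (stack_tape s i)) =
    stack_tape (n # s) (i - 1)"
  by (auto simp: stack_tape_def fun_eq_iff nth_Cons' nat_diff_distrib nat_less_iff
      intro!: arg_cong[where f = h] arg_cong2[where f = nth])

text \<open>On an empty stack the head still moves right, but over a blank tape, which again
  represents the empty stack.\<close>

lemma stack_tape_pop:
  "tape_act (Blank, MoveRight) (stack_tape s i) = stack_tape (tl s) (i + 1)"
  by (auto simp: stack_tape_def fun_eq_iff nth_tl nat_less_iff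
      intro!: arg_cong[where f = h] arg_cong2[where f = nth])

lemma output_tape_emit:
  "tape_act (h n, MoveRight) (output_tape v) = output_tape (v @ [n])"
  by (auto simp: output_tape_def fun_eq_iff nth_append)

text \<open>Head positions are left open because only the contents relative to the head matter.
  Stacks without a tape are unconstrained: programs whose indices fit below \<open>N\<close> never
  touch them.\<close>

definition represents :: "('k \<Rightarrow> stack) \<times> nat list \<Rightarrow> 'a tape list \<Rightarrow> bool" where
  "represents \<sigma> ts \<longleftrightarrow> length ts = Suc N \<and> ts ! N = output_tape (snd \<sigma>) \<and>
    (\<forall>k. ix k < N \<longrightarrow> (\<exists>i. ts ! ix k = stack_tape (fst \<sigma> k) i))"

lemma machine_step:
  "cs \<noteq> [] \<Longrightarrow> tm_step (machine \<Sigma> c) (to_nat cs, ts) =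
    (case next_control cs (map tape_read ts) of (cs', acts) \<Rightarrow> (to_nat cs', map2 tape_act acts ts))"
  by (auto simp: machine_def split: prod.splits)

lemma represents_read:
  assumes "represents \<sigma> ts" "ix k < N"
  shows "map tape_read ts ! ix k = (case fst \<sigma> k of [] \<Rightarrow> Blank | n # _ \<Rightarrow> h n)"
  using assms by (fastforce simp: represents_def tape_read_stack)

lemma represents_update:
  assumes "represents (\<sigma>, v) ts" "ix k < N"
  shows "represents (\<sigma>(k := s), v) (ts[ix k := stack_tape s i])"
  using assms inj_ix by (auto simp: represents_def nth_list_update inj_eq)

lemma represents_emit:
  assumes "represents (\<sigma>, v) ts"
  shows "represents (\<sigma>, u) (ts[N := output_tape u])"
  using assms by (auto simp: represents_def nth_list_update)

lemma machine_push:
  assumes "represents (\<sigma>, v) ts" "ix k < N"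
  defines "ts' \<equiv> ts[ix k := tape_act (tape_read (ts ! ix k), MoveLeft) (ts ! ix k)]"
  shows "represents (\<sigma>(k := n # \<sigma> k), v) (ts'[ix k := tape_act (h n, Stay) (ts' ! ix k)])"
proof -
  obtain i where i: "ts ! ix k = stack_tape (\<sigma> k) i" "length ts = Suc N"
    using assms by (auto simp: represents_def)
  then have "ts'[ix k := tape_act (h n, Stay) (ts' ! ix k)] = ts[ix k := stack_tape (n # \<sigma> k) (i - 1)]"
    using assms(2) by (simp add: ts'_def stack_tape_push)
  then show ?thesis
    using represents_update[OF assms(1,2)] by simp
qed

text \<open>The step counts of \<open>run\<close> are those of the machine, so the simulation is
  exact. The arbitrary continuation \<open>cs\<close> lets sequences and loops chain the induction
  hypotheses; the start command \<open>c\<^sub>0\<close> is arbitrary because transitions do not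
  depend on it.\<close>

lemma machine_run:
  assumes "run c \<sigma> t \<sigma>'" "ix ` indices c \<subseteq> {..<N}" "copies_proper c" "represents \<sigma> ts"
  shows "\<exists>ts'. (tm_step (machine \<Sigma> c\<^sub>0) ^^ t) (to_nat (c # cs), ts) = (to_nat cs, ts') \<and>
    represents \<sigma>' ts'"
  using assms
proof (induction arbitrary: ts cs rule: run.induct)
  case (run_Nop \<sigma>)
  then show ?case by (simp add: machine_step map2_tape_act_idle del: tm_step.simps)
next
  case (run_Push k n \<sigma> v)
  then show ?case
    using machine_push[of \<sigma> v ts k n]
    by (simp add: machine_step map2_tape_act_update numeral_2_eq_2 represents_def
        del: tm_step.simps tape_act.simps)
next
  case (run_Pop k \<sigma> v)
  then obtain i where "ts ! ix k = stack_tape (\<sigma> k) i"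
    by (auto simp: represents_def)
  then show ?case
    using run_Pop represents_update[of \<sigma> v ts k]
    by (simp add: machine_step map2_tape_act_update stack_tape_pop
        del: tm_step.simps tape_act.simps)
next
  case (run_Copy \<sigma> j a s k v)
  have len: "length ts = Suc N" and k: "ix k < N" and j: "ix j < N" and neq: "ix j \<noteq> ix k"
    using run_Copy inj_ix by (auto simp: represents_def inj_eq)
  have "tape_read (ts ! ix j) = h a"
    using represents_read[OF run_Copy.prems(3) j] run_Copy.hyps len j by simp
  then show ?case
    using machine_push[OF run_Copy.prems(3) k, of a] len k j neq
    by (simp add: machine_step map2_tape_act_update numeral_2_eq_2
        del: tm_step.simps tape_act.simps)
next
  case (run_Emit \<sigma> j a s v)
  have len: "length ts = Suc N" and j: "ix j < N" and out: "ts ! N = output_tape v"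
    using run_Emit by (auto simp: represents_def)
  have "tape_read (ts ! ix j) = h a"
    using represents_read[OF run_Emit.prems(3) j] run_Emit.hyps len j by simp
  then show ?case
    using represents_emit[OF run_Emit.prems(3), of "v @ [a]"] len j out
    by (simp add: machine_step map2_tape_act_update output_tape_emit
        del: tm_step.simps tape_act.simps)
next
  case (run_Seq a \<sigma> t \<sigma>' b u \<sigma>'')
  let ?F = "tm_step (machine \<Sigma> c\<^sub>0)"
  obtain ts' where 1: "(?F ^^ t) (to_nat (a # b # cs), ts) = (to_nat (b # cs), ts')" "represents \<sigma>' ts'"
    using run_Seq.IH(1)[of ts "b # cs"] run_Seq.prems by auto
  obtain ts'' where 2: "(?F ^^ u) (to_nat (b # cs), ts') = (to_nat cs, ts'')" "represents \<sigma>'' ts''"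
    using run_Seq.IH(2)[of ts' cs] run_Seq.prems 1 by auto
  have "?F (to_nat (CSeq a b # cs), ts) = (to_nat (a # b # cs), ts)"
    by (simp add: machine_step map2_tape_act_idle del: tm_step.simps)
  then show ?case
    using funpow_step[OF _ funpow_trans[OF 1(1) 2(1)]] 2(2) by blast
next
  case (run_If_true n \<sigma> k a t \<sigma>' b)
  then have "map tape_read ts ! ix k = h n"
    by (subst represents_read[of \<sigma>]) (auto simp: top_is_def)
  then have "tm_step (machine \<Sigma> c\<^sub>0) (to_nat (CIf k n a b # cs), ts) = (to_nat (a # cs), ts)"
    by (simp add: machine_step map2_tape_act_idle del: tm_step.simps)
  then show ?case
    using run_If_true.IH[of ts cs] run_If_true.prems
    by (simp add: funpow_swap1 image_Un del: tm_step.simps)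
next
  case (run_If_false n \<sigma> k b t \<sigma>' a)
  \<comment> \<open>The head reads a blank if the stack is empty and the symbol of another number
    otherwise; \<open>h_not_Blank\<close> and the injectivity of \<open>h\<close> settle the two
    cases.\<close>
  then have "map tape_read ts ! ix k \<noteq> h n"
    using inj_h h_not_Blank[of n]
    by (subst represents_read[of \<sigma>]) (auto simp: top_is_def inj_eq split: list.splits)
  then have "tm_step (machine \<Sigma> c\<^sub>0) (to_nat (CIf k n a b # cs), ts) = (to_nat (b # cs), ts)"
    by (simp add: machine_step map2_tape_act_idle del: tm_step.simps)
  then show ?case
    using run_If_false.IH[of ts cs] run_If_false.prems
    by (simp add: funpow_swap1 image_Un del: tm_step.simps)
next
  case (run_While_true \<sigma> k a t \<sigma>' u \<sigma>'')
  let ?F = "tm_step (machine \<Sigma> c\<^sub>0)"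
  let ?w = "CWhile k a"
  obtain ts' where 1: "(?F ^^ t) (to_nat (a # ?w # cs), ts) = (to_nat (?w # cs), ts')" "represents \<sigma>' ts'"
    using run_While_true.IH(1)[of ts "?w # cs"] run_While_true.prems by auto
  obtain ts'' where 2: "(?F ^^ u) (to_nat (?w # cs), ts') = (to_nat cs, ts'')" "represents \<sigma>'' ts''"
    using run_While_true.IH(2)[of ts' cs] run_While_true.prems 1 by auto
  have "map tape_read ts ! ix k \<noteq> Blank"
    using run_While_true h_not_Blank
    by (subst represents_read[of \<sigma>]) (auto split: list.splits)
  then have "?F (to_nat (?w # cs), ts) = (to_nat (a # ?w # cs), ts)"
    by (simp add: machine_step map2_tape_act_idle del: tm_step.simps)
  then show ?case
    using funpow_step[OF _ funpow_trans[OF 1(1) 2(1)]] 2(2) by blast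
next
  case (run_While_false \<sigma> k a)
  then have "map tape_read ts ! ix k = Blank"
    by (subst represents_read[of \<sigma>]) auto
  then show ?case
    using run_While_false by (simp add: machine_step map2_tape_act_idle del: tm_step.simps)
qed

end

section \<open>Compilation of ForNo terms\<close>

text \<open>
  \<open>Cnt\<close> holds the error counter in unary, and \<open>Aux d\<close> the elements that an iteration at nesting
  depth \<open>d\<close> still has to process.
\<close>

datatype 'r index = Reg 'r | Cnt | Tmp | Aux nat

instance index :: (countable) countable
  by countable_datatype

text \<open>\<open>Tmp\<close> is empty before and after every source statement; it is filled only
  while a loop leader is being duplicated.\<close>

definition layout :: "'r state \<Rightarrow> (nat \<Rightarrow> stack) \<Rightarrow> 'r index \<Rightarrow> stack" where
  "layout \<omega> A = case_index (fst \<omega>) (replicate (snd \<omega>) 0) [] A"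

lemma layout_simps [simp]:
  "layout \<omega> A (Reg x) = fst \<omega> x"
  "layout \<omega> A Cnt = replicate (snd \<omega>) 0"
  "layout \<omega> A Tmp = []"
  "layout \<omega> A (Aux e) = A e"
  by (simp_all add: layout_def)

lemma layout_Reg: "(layout \<omega> A)(Reg x := s) = layout ((fst \<omega>)(x := s), snd \<omega>) A"
  by (auto simp: layout_def fun_eq_iff split: index.splits)

lemma layout_Cnt: "(layout \<omega> A)(Cnt := replicate c 0) = layout (fst \<omega>, c) A"
  by (auto simp: layout_def fun_eq_iff split: index.splits)

lemma layout_Aux: "(layout \<omega> A)(Aux d := s) = layout \<omega> (A(d := s))"
  by (auto simp: layout_def fun_eq_iff split: index.splits)

text \<open>\<open>Cnt\<close> contains only zeros, so testing it for top 0 asks whether the error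
  counter is nonzero. The branches then follow the concrete \<open>push\<close> and
  \<open>pop\<close>.\<close>

fun comp_atom :: "'r atom \<Rightarrow> 'r index com" where
  "comp_atom Skip = CNop"
| "comp_atom (Push n x) =
    CIf Cnt 0 (CIf (Reg x) n CNop (CPop Cnt)) (CPush (Reg x) n)"
| "comp_atom (Pop n x) =
    CIf (Reg x) n (CIf Cnt 0 CNop (CPop (Reg x))) (CPush Cnt 0)"

lemma top_is_Nil [simp]: "\<not> top_is n []"
  by (simp add: top_is_def)

lemma top_is_replicate: "top_is 0 (replicate c 0) \<longleftrightarrow> c \<noteq> 0"
  by (cases c) (auto simp: top_is_def)

lemma run_comp_atom:
  "\<exists>t\<le>4. run (comp_atom a) (layout \<omega> A, v) t (layout (exec_atom a \<omega>) A, v)"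
proof (cases a)
  case Skip
  have "run CNop (layout \<omega> A, v) (Suc 0) (layout \<omega> A, v)"
    by (rule run_Nop)
  then show ?thesis
    using Skip by (cases \<omega>) (auto intro!: exI[of _ "Suc 0"])
next
  case (Push n x)
  consider "snd \<omega> = 0" | "snd \<omega> \<noteq> 0" "top_is n (fst \<omega> x)" | "snd \<omega> \<noteq> 0" "\<not> top_is n (fst \<omega> x)"
    by blast
  then show ?thesis
  proof cases
    case 1
    have "run (comp_atom a) (layout \<omega> A, v) (Suc 2) ((layout \<omega> A)(Reg x := n # layout \<omega> A (Reg x)), v)"
      unfolding Push comp_atom.simps
      by (rule run_If_false, simp add: top_is_replicate 1, rule run_Push)
    then show ?thesis
      using 1 Push by (cases \<omega>) (auto simp: layout_Reg intro!: exI[of _ "Suc 2"])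
  next
    case 2
    have "run (comp_atom a) (layout \<omega> A, v) (Suc (Suc (Suc 0))) (layout \<omega> A, v)"
      unfolding Push comp_atom.simps
      by (intro run_If_true run_Nop) (simp_all add: top_is_replicate 2)
    then show ?thesis
      using 2 Push by (cases \<omega>) (auto simp: layout_Reg intro!: exI[of _ "Suc (Suc (Suc 0))"])
  next
    case 3
    have "run (comp_atom a) (layout \<omega> A, v) (Suc (Suc (Suc 0))) ((layout \<omega> A)(Cnt := tl (layout \<omega> A Cnt)), v)"
      unfolding Push comp_atom.simps
      by (rule run_If_true, simp add: top_is_replicate 3, rule run_If_false, simp add: 3, rule run_Pop)
    then show ?thesis
      using 3 Push by (cases \<omega>) (auto simp: layout_Cnt intro!: exI[of _ "Suc (Suc (Suc 0))"])
  qed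
next
  case (Pop n x)
  consider "\<not> top_is n (fst \<omega> x)" | "snd \<omega> = 0" "top_is n (fst \<omega> x)" | "snd \<omega> \<noteq> 0" "top_is n (fst \<omega> x)"
    by blast
  then show ?thesis
  proof cases
    case 1
    have "run (comp_atom a) (layout \<omega> A, v) (Suc 2) ((layout \<omega> A)(Cnt := 0 # layout \<omega> A Cnt), v)"
      unfolding Pop comp_atom.simps
      by (rule run_If_false, simp add: 1, rule run_Push)
    then show ?thesis
      using 1 Pop layout_Cnt[of \<omega> A "Suc (snd \<omega>)"]
      by (cases \<omega>) (auto intro!: exI[of _ "Suc 2"])
  next
    case 2
    have "run (comp_atom a) (layout \<omega> A, v) (Suc (Suc (Suc 0))) ((layout \<omega> A)(Reg x := tl (layout \<omega> A (Reg x))), v)"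
      unfolding Pop comp_atom.simps
      by (rule run_If_true, simp add: 2, rule run_If_false, simp add: 2 top_is_replicate, rule run_Pop)
    then show ?thesis
      using 2 Pop by (cases \<omega>) (auto simp: layout_Reg intro!: exI[of _ "Suc (Suc (Suc 0))"])
  next
    case 3
    have "run (comp_atom a) (layout \<omega> A, v) (Suc (Suc (Suc 0))) (layout \<omega> A, v)"
      unfolding Pop comp_atom.simps
      by (intro run_If_true run_Nop) (simp_all add: top_is_replicate 3)
    then show ?thesis
      using 3 Pop by (cases \<omega>) (auto simp: layout_Reg intro!: exI[of _ "Suc (Suc (Suc 0))"])
  qed
qed

section \<open>Duplicating stacks and compiling iterations\<close>

definition transfer :: "'k \<Rightarrow> 'k \<Rightarrow> 'k com" where
  "transfer a b = CWhile a (CSeq (CCopy a b) (CPop a))"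

definition transfer2 :: "'k \<Rightarrow> 'k \<Rightarrow> 'k \<Rightarrow> 'k com" where
  "transfer2 a b c = CWhile a (CSeq (CCopy a b) (CSeq (CCopy a c) (CPop a)))"

text \<open>A round costs 5 steps: 2 for the copy and 1 each for the pop, the sequencing and the
  loop test. The final test adds 1. In \<open>transfer2\<close> a second copy and sequencing raise
  the round to 8.\<close>

lemma run_transfer:
  assumes "a \<noteq> b"
  shows "run (transfer a b) (\<sigma>, v) (5 * length (\<sigma> a) + 1) (\<sigma>(a := [], b := rev (\<sigma> a) @ \<sigma> b), v)"
  unfolding transfer_def
proof (induction "\<sigma> a" arbitrary: \<sigma>)
  case Nil
  then have "\<sigma>(a := [], b := rev (\<sigma> a) @ \<sigma> b) = \<sigma>"
    by (simp add: fun_upd_idem)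
  then show ?case
    using Nil run_While_false[of "(\<sigma>, v)" a] by (simp del: fun_upd_apply)
next
  case (Cons n s)
  note \<sigma>a = Cons.hyps(2)[symmetric]
  let ?w = "CWhile a (CSeq (CCopy a b) (CPop a))"
  let ?\<sigma>1 = "\<sigma>(b := n # \<sigma> b)"
  let ?\<sigma>' = "?\<sigma>1(a := tl (?\<sigma>1 a))"
  let ?\<tau> = "\<lambda>\<sigma> s. \<sigma>(a := [], b := rev s @ \<sigma> b)"
  have "run (CSeq (CCopy a b) (CPop a)) (\<sigma>, v) (Suc (2 + Suc 0)) (?\<sigma>', v)"
    by (rule run_Seq[OF run_Copy run_Pop]) (rule \<sigma>a)
  moreover have "?\<sigma>' a = s"
    using \<sigma>a assms by simp
  then have "run ?w (?\<sigma>', v) (5 * length s + 1) (?\<tau> ?\<sigma>' s, v)"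
    using Cons.hyps(1)[of ?\<sigma>'] by (simp del: fun_upd_apply)
  \<comment> \<open>Moving one element ahead does not change the final store, since
    \<open>rev (n # s) @ t = rev s @ n # t\<close>.\<close>
  moreover have "?\<tau> ?\<sigma>' s = ?\<tau> \<sigma> (n # s)"
    using assms by (auto simp: fun_eq_iff)
  ultimately have "run ?w (\<sigma>, v) (Suc (Suc (2 + Suc 0) + (5 * length s + 1))) (?\<tau> \<sigma> (n # s), v)"
    using \<sigma>a by (intro run_While_true) (simp_all del: fun_upd_apply)
  then show ?case
    by (simp add: \<sigma>a del: fun_upd_apply)
qed

lemma run_transfer2:
  assumes "a \<noteq> b" "a \<noteq> c" "b \<noteq> c"
  shows "run (transfer2 a b c) (\<sigma>, v) (8 * length (\<sigma> a) + 1)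
    (\<sigma>(a := [], b := rev (\<sigma> a) @ \<sigma> b, c := rev (\<sigma> a) @ \<sigma> c), v)"
  unfolding transfer2_def
proof (induction "\<sigma> a" arbitrary: \<sigma>)
  case Nil
  then have "\<sigma>(a := [], b := rev (\<sigma> a) @ \<sigma> b, c := rev (\<sigma> a) @ \<sigma> c) = \<sigma>"
    by (simp add: fun_upd_idem)
  then show ?case
    using Nil run_While_false[of "(\<sigma>, v)" a] by (simp del: fun_upd_apply)
next
  case (Cons n s)
  note \<sigma>a = Cons.hyps(2)[symmetric]
  let ?w = "CWhile a (CSeq (CCopy a b) (CSeq (CCopy a c) (CPop a)))"
  let ?\<sigma>1 = "\<sigma>(b := n # \<sigma> b)"
  let ?\<sigma>2 = "?\<sigma>1(c := n # ?\<sigma>1 c)"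
  let ?\<sigma>' = "?\<sigma>2(a := tl (?\<sigma>2 a))"
  let ?\<tau> = "\<lambda>\<sigma> s. \<sigma>(a := [], b := rev s @ \<sigma> b, c := rev s @ \<sigma> c)"
  have "?\<sigma>1 a = n # s"
    using \<sigma>a assms by simp
  then have "run (CSeq (CCopy a b) (CSeq (CCopy a c) (CPop a))) (\<sigma>, v)
      (Suc (2 + Suc (2 + Suc 0))) (?\<sigma>', v)"
    by (rule run_Seq[OF run_Copy run_Seq[OF run_Copy run_Pop], rotated]) (rule \<sigma>a)
  moreover have "?\<sigma>' a = s"
    using \<sigma>a assms by simp
  then have "run ?w (?\<sigma>', v) (8 * length s + 1) (?\<tau> ?\<sigma>' s, v)"
    using Cons.hyps(1)[of ?\<sigma>'] by (simp del: fun_upd_apply)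
  moreover have "?\<tau> ?\<sigma>' s = ?\<tau> \<sigma> (n # s)"
    using assms by (auto simp: fun_eq_iff)
  ultimately have "run ?w (\<sigma>, v) (Suc (Suc (2 + Suc (2 + Suc 0)) + (8 * length s + 1))) (?\<tau> \<sigma> (n # s), v)"
    using \<sigma>a by (intro run_While_true) (simp_all del: fun_upd_apply)
  then show ?case
    by (simp add: \<sigma>a del: fun_upd_apply)
qed

text \<open>The last body is reached without a test and serves as the default; this realises the cap
  in \<open>min i k\<close>.\<close>

fun dispatch :: "'k \<Rightarrow> nat \<Rightarrow> 'k com list \<Rightarrow> 'k com" where
  "dispatch k n [] = CNop"
| "dispatch k n [c] = c"
| "dispatch k n (c # c' # cs) = CIf k n c (dispatch k (Suc n) (c' # cs))"

text \<open>Every test costs one step, and there are fewer tests than bodies. The offset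
  \<open>n\<close> makes the induction work: a failed test raises it and drops one body.\<close>

lemma run_dispatch:
  assumes "cs \<noteq> []" "\<sigma> k = i # s" "n \<le> i"
    and "run (cs ! min (i - n) (length cs - 1)) (\<sigma>, v) t \<sigma>'"
  shows "\<exists>u\<le>t + length cs. run (dispatch k n cs) (\<sigma>, v) u \<sigma>'"
  using assms
proof (induction k n cs rule: dispatch.induct)
  case (2 k n c)
  then show ?case by (auto intro!: exI[of _ t])
next
  case (3 k n c c' cs)
  show ?case
  proof (cases "i = n")
    case True
    then have "run (dispatch k n (c # c' # cs)) (\<sigma>, v) (Suc t) \<sigma>'"
      using 3 by (auto intro!: run_If_true simp: top_is_def)
    then show ?thesis by (auto intro!: exI[of _ "Suc t"])
  next
    case False
    then have "min (i - n) (Suc (length cs)) = Suc (min (i - Suc n) (length cs))"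
      using 3(4) by linarith
    then obtain u where u: "u \<le> t + length (c' # cs)" "run (dispatch k (Suc n) (c' # cs)) (\<sigma>, v) u \<sigma>'"
      using 3 False by auto
    then have "run (dispatch k n (c # c' # cs)) (\<sigma>, v) (Suc u) \<sigma>'"
      using 3 False by (auto intro!: run_If_false simp: top_is_def)
    then show ?thesis
      using u by (auto intro!: exI[of _ "Suc u"])
  qed
qed simp

text \<open>The current element stays on \<open>Aux d\<close> while its body runs and is popped only
  afterwards.\<close>

definition comp_loop :: "nat \<Rightarrow> 'r index com list \<Rightarrow> 'r index com" where
  "comp_loop d cs = CWhile (Aux d) (CSeq (dispatch (Aux d) 0 cs) (CPop (Aux d)))"

text \<open>Stacks are read destructively and each pass reverses them. For \<open>SFor\<close> the
  pending elements are reversed twice, for \<open>SRof\<close> once; the leader is restored by two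
  reversals in both cases. Bodies work at depth \<open>Suc d\<close> and so preserve
  \<open>Aux d\<close>.\<close>

fun comp_stm :: "nat \<Rightarrow> 'r stm \<Rightarrow> 'r index com" where
  "comp_stm d (SAtom a) = comp_atom a"
| "comp_stm d (SSeq P Q) = CSeq (comp_stm d P) (comp_stm d Q)"
| "comp_stm d (SIf x n P) = CIf (Reg x) n (comp_stm d P) CNop"
| "comp_stm d (SFor x P Ps) =
    CSeq (transfer (Reg x) Tmp) (CSeq (transfer2 Tmp (Reg x) (Aux d))
      (comp_loop d (comp_stm (Suc d) P # map (comp_stm (Suc d)) Ps)))"
| "comp_stm d (SRof x P Ps) =
    CSeq (transfer2 (Reg x) Tmp (Aux d)) (CSeq (transfer Tmp (Reg x))
      (comp_loop d (comp_stm (Suc d) P # map (comp_stm (Suc d)) Ps)))"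

text \<open>The variable stands for a common bound on the lengths of the loop leaders. In
  \<open>17 + length Ps\<close>, 13 steps per element pay for the two passes over the leader and
  \<open>4 + length Ps\<close> for loop control. The sum over the bodies dominates whichever body is
  selected.\<close>

fun cost_stm :: "'r stm \<Rightarrow> nat poly" where
  "cost_stm (SAtom a) = [:4:]"
| "cost_stm (SSeq P Q) = cost_stm P + cost_stm Q + 1"
| "cost_stm (SIf x n P) = cost_stm P + [:2:]"
| "cost_stm (SFor x P Ps) =
    [:5, 17 + length Ps:] + [:0, 1:] * (cost_stm P + sum_list (map cost_stm Ps))"
| "cost_stm (SRof x P Ps) =
    [:5, 17 + length Ps:] + [:0, 1:] * (cost_stm P + sum_list (map cost_stm Ps))"

text \<open>Applied to loop leaders, this keeps their lengths fixed during a block, so that one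
  bound \<open>L\<close> serves all iterations, nested ones included.\<close>

lemma exec_unwritten:
  "exec_stm P \<omega> \<omega>' \<Longrightarrow> x \<notin> writes_stm P \<Longrightarrow> fst \<omega>' x = fst \<omega> x"
  "exec_iter Ps is \<omega> \<omega>' \<Longrightarrow> Ps \<noteq> [] \<Longrightarrow> \<forall>P\<in>set Ps. x \<notin> writes_stm P \<Longrightarrow> fst \<omega>' x = fst \<omega> x"
proof (induction rule: exec_stm_exec_iter.inducts)
  case (exec_SAtom a \<omega>)
  then show ?case by (cases a; cases \<omega>) auto
next
  case (exec_iter_Cons Ps i \<omega> \<omega>' "is" \<omega>'')
  then have "Ps ! min i (length Ps - 1) \<in> set Ps"
    by (intro nth_mem) (cases Ps, auto)
  then show ?case
    using exec_iter_Cons by auto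
qed auto

inductive_cases exec_SAtomE: "exec_stm (SAtom a) \<omega> \<omega>'"
inductive_cases exec_SSeqE: "exec_stm (SSeq P Q) \<omega> \<omega>'"
inductive_cases exec_SIfE: "exec_stm (SIf x n P) \<omega> \<omega>'"
inductive_cases exec_SForE: "exec_stm (SFor x P Ps) \<omega> \<omega>'"
inductive_cases exec_SRofE: "exec_stm (SRof x P Ps) \<omega> \<omega>'"
inductive_cases exec_iter_NilE: "exec_iter Ps [] \<omega> \<omega>'"
inductive_cases exec_iter_ConsE: "exec_iter Ps (i # is) \<omega> \<omega>'"

lemma poly_sum_list: "poly (sum_list ps) x = (\<Sum>p\<leftarrow>ps. poly p x)"
  by (induction ps) auto

text \<open>Correctness of the bodies enters as the assumption \<open>body\<close>, to be supplied
  by the structural induction hypothesis for \<open>SFor\<close> and \<open>SRof\<close> alike. The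
  3 extra steps of a round are the loop test, the sequencing and the pop.\<close>

lemma run_comp_loop:
  assumes body: "\<And>Q \<omega> \<omega>' A. Q \<in> set Qs \<Longrightarrow> Y \<inter> writes_stm Q = {} \<Longrightarrow>
      iteration_leaders Q \<subseteq> Y \<Longrightarrow> exec_stm Q \<omega> \<omega>' \<Longrightarrow>
      \<forall>x\<in>Y. length (fst \<omega> x) \<le> L \<Longrightarrow> \<forall>e\<ge>Suc d. A e = [] \<Longrightarrow>
      \<exists>t\<le>poly (cost_stm Q) L. run (comp_stm (Suc d) Q) (layout \<omega> A, v) t (layout \<omega>' A, v)"
    and writes: "\<forall>Q\<in>set Qs. Y \<inter> writes_stm Q = {} \<and> iteration_leaders Q \<subseteq> Y"
    and "Qs \<noteq> []"
    and "exec_iter Qs is \<omega> \<omega>'" "\<forall>x\<in>Y. length (fst \<omega> x) \<le> L" "\<forall>e\<ge>d. A e = []"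
  shows "\<exists>t\<le>1 + length is * (3 + length Qs + poly (sum_list (map cost_stm Qs)) L).
    run (comp_loop d (map (comp_stm (Suc d)) Qs)) (layout \<omega> (A(d := is)), v) t (layout \<omega>' A, v)"
  using assms(4-6)
proof (induction "is" arbitrary: \<omega>)
  case Nil
  then have "\<omega>' = \<omega>" "A(d := []) = A"
    by (auto elim: exec_iter_NilE simp: fun_upd_idem)
  then have "run (comp_loop d (map (comp_stm (Suc d)) Qs)) (layout \<omega> (A(d := [])), v) (Suc 0) (layout \<omega>' A, v)"
    using Nil.prems(3) unfolding comp_loop_def by (auto intro: run_While_false)
  then show ?case by (auto simp del: fun_upd_apply)
next
  case (Cons i "is")
  let ?b = "poly (sum_list (map cost_stm Qs)) L"
  let ?cs = "map (comp_stm (Suc d)) Qs"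
  let ?Q = "Qs ! min i (length Qs - 1)"
  let ?A = "A(d := i # is)"
  obtain \<omega>1 where \<omega>1: "exec_stm ?Q \<omega> \<omega>1" "exec_iter Qs is \<omega>1 \<omega>'"
    using Cons.prems(1) by (auto elim: exec_iter_ConsE)
  have lt: "min i (length Qs - 1) < length Qs"
    using \<open>Qs \<noteq> []\<close> by (cases Qs) auto
  then have Q: "?Q \<in> set Qs"
    by (rule nth_mem)
  \<comment> \<open>The body runs while \<open>Aux d\<close> is nonempty; at depth
    \<open>Suc d\<close> only the auxiliary stacks from \<open>Suc d\<close> on must be
    empty.\<close>
  obtain t where "t \<le> poly (cost_stm ?Q) L"
      and t: "run (comp_stm (Suc d) ?Q) (layout \<omega> ?A, v) t (layout \<omega>1 ?A, v)"
    using body[OF Q _ _ \<omega>1(1) Cons.prems(2), of ?A] Cons.prems(3) writes Q by auto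
  then have "t \<le> ?b"
    using Q member_le_sum_list[of "poly (cost_stm ?Q) L" "map (\<lambda>Q. poly (cost_stm Q) L) Qs"]
    by (auto simp: poly_sum_list comp_def)
  obtain u where u: "u \<le> t + length Qs" "run (dispatch (Aux d) 0 ?cs) (layout \<omega> ?A, v) u (layout \<omega>1 ?A, v)"
    using run_dispatch[of ?cs "layout \<omega> ?A" "Aux d" i "is" 0 v t "(layout \<omega>1 ?A, v)"] t \<open>Qs \<noteq> []\<close> lt
    by auto
  have "\<forall>x\<in>Y. length (fst \<omega>1 x) \<le> L"
    using exec_unwritten(1)[OF \<omega>1(1)] writes Q Cons.prems(2) by (metis disjoint_iff)
  then obtain r where r: "r \<le> 1 + length is * (3 + length Qs + ?b)"
    "run (comp_loop d ?cs) (layout \<omega>1 (A(d := is)), v) r (layout \<omega>' A, v)"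
    using Cons.IH[OF \<omega>1(2)] Cons.prems(3) by blast
  have "run (CPop (Aux d)) (layout \<omega>1 ?A, v) (Suc 0) (layout \<omega>1 (A(d := is)), v)"
    using run_Pop[of "Aux d" "layout \<omega>1 ?A" v] by (simp add: layout_Aux)
  then have "run (comp_loop d ?cs) (layout \<omega> ?A, v) (Suc (Suc (u + Suc 0) + r)) (layout \<omega>' A, v)"
    using r(2) u(2) unfolding comp_loop_def
    by (intro run_While_true[OF _ run_Seq]) auto
  moreover have "Suc (Suc (u + Suc 0) + r) \<le> 1 + length (i # is) * (3 + length Qs + ?b)"
    using r(1) u(1) \<open>t \<le> ?b\<close> by simp
  ultimately show ?case by blast
qed

text \<open>Iteration counts depend only on leaders, so lengths need to be bounded only on the
  unwritten registers \<open>Y\<close>, however much the other stacks grow.\<close>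

lemma run_comp_stm:
  assumes "Y \<inter> writes_stm S = {}" "iteration_leaders S \<subseteq> Y" "exec_stm S \<omega> \<omega>'"
    and "\<forall>x\<in>Y. length (fst \<omega> x) \<le> L" "\<forall>e\<ge>d. A e = []"
  shows "\<exists>t\<le>poly (cost_stm S) L. run (comp_stm d S) (layout \<omega> A, v) t (layout \<omega>' A, v)"
  using assms
proof (induction S arbitrary: \<omega> \<omega>' d A)
  case (SAtom a)
  then show ?case
    using run_comp_atom[of a \<omega> A v] by (auto elim: exec_SAtomE)
next
  case (SSeq P Q)
  obtain \<omega>1 where \<omega>1: "exec_stm P \<omega> \<omega>1" "exec_stm Q \<omega>1 \<omega>'"
    using SSeq.prems(3) by (rule exec_SSeqE)
  obtain t where t: "t \<le> poly (cost_stm P) L" "run (comp_stm d P) (layout \<omega> A, v) t (layout \<omega>1 A, v)"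
    using SSeq.IH(1)[OF _ _ \<omega>1(1) SSeq.prems(4,5)] SSeq.prems(1,2) by auto
  have le: "\<forall>x\<in>Y. length (fst \<omega>1 x) \<le> L"
  proof
    fix x
    assume "x \<in> Y"
    moreover from this have "x \<notin> writes_stm P"
      using SSeq.prems(1) by auto
    ultimately show "length (fst \<omega>1 x) \<le> L"
      using exec_unwritten(1)[OF \<omega>1(1)] SSeq.prems(4) by auto
  qed
  obtain u where u: "u \<le> poly (cost_stm Q) L" "run (comp_stm d Q) (layout \<omega>1 A, v) u (layout \<omega>' A, v)"
    using SSeq.IH(2)[OF _ _ \<omega>1(2) le SSeq.prems(5)] SSeq.prems(1,2) by auto
  show ?case
    using run_Seq[OF t(2) u(2)] t(1) u(1) by (auto intro!: exI[of _ "Suc (t + u)"])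
next
  case (SIf x n P)
  show ?case
  proof (cases "top_is n (fst \<omega> x)")
    case True
    then have "exec_stm P \<omega> \<omega>'"
      using SIf.prems(3) by (auto elim: exec_SIfE)
    then obtain t where t: "t \<le> poly (cost_stm P) L" "run (comp_stm d P) (layout \<omega> A, v) t (layout \<omega>' A, v)"
      using SIf.IH[of \<omega> \<omega>' d A] SIf.prems by auto
    have "run (comp_stm d (SIf x n P)) (layout \<omega> A, v) (Suc t) (layout \<omega>' A, v)"
      using t(2) True by (auto intro: run_If_true)
    then show ?thesis
      using t(1) by (auto intro!: exI[of _ "Suc t"])
  next
    case False
    then have "\<omega>' = \<omega>"
      using SIf.prems(3) by (auto elim: exec_SIfE)
    then have "run (comp_stm d (SIf x n P)) (layout \<omega> A, v) (Suc (Suc 0)) (layout \<omega>' A, v)"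
      using False by (auto intro: run_If_false run_Nop)
    then show ?thesis
      by (auto intro!: exI[of _ "Suc (Suc 0)"])
  qed
next
  case (SFor x P Ps)
  let ?s = "fst \<omega> x"
  let ?b = "poly (sum_list (map cost_stm (P # Ps))) L"
  have body: "\<exists>t\<le>poly (cost_stm Q) L. run (comp_stm (Suc d) Q) (layout \<omega> A, v) t (layout \<omega>' A, v)"
    if "Q \<in> set (P # Ps)" "Y \<inter> writes_stm Q = {}" "iteration_leaders Q \<subseteq> Y" "exec_stm Q \<omega> \<omega>'"
      "\<forall>x\<in>Y. length (fst \<omega> x) \<le> L" "\<forall>e\<ge>Suc d. A e = []" for Q \<omega> \<omega>' A
    using SFor.IH(1)[of \<omega> \<omega>' "Suc d" A] SFor.IH(2)[of Q \<omega> \<omega>' "Suc d" A] that by auto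
  have bodies: "\<forall>Q\<in>set (P # Ps). Y \<inter> writes_stm Q = {} \<and> iteration_leaders Q \<subseteq> Y"
    using SFor.prems(1,2) by auto
  have iter: "exec_iter (P # Ps) ?s \<omega> \<omega>'"
    using SFor.prems(3) by (rule exec_SForE)
  have "\<exists>t\<le>1 + length ?s * (3 + length (P # Ps) + ?b). run (comp_loop d (map (comp_stm (Suc d)) (P # Ps)))
      (layout \<omega> (A(d := ?s)), v) t (layout \<omega>' A, v)"
    by (rule run_comp_loop[OF body bodies _ iter SFor.prems(4,5)]) simp_all
  then obtain t where t: "t \<le> 1 + length ?s * (3 + length (P # Ps) + ?b)"
    "run (comp_loop d (map (comp_stm (Suc d)) (P # Ps))) (layout \<omega> (A(d := ?s)), v) t (layout \<omega>' A, v)"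
    unfolding length_rev by blast
  let ?\<sigma> = "(layout \<omega> A)(Reg x := [], Tmp := rev ?s)"
  have "run (transfer (Reg x) Tmp) (layout \<omega> A, v) (5 * length ?s + 1) (?\<sigma>, v)"
    using run_transfer[of "Reg x" Tmp "layout \<omega> A" v] by simp
  \<comment> \<open>The second reversal restores the leader and lists the pending elements from the
    top down.\<close>
  moreover have "?\<sigma>(Tmp := [], Reg x := ?s, Aux d := ?s) = layout \<omega> (A(d := ?s))"
    by (auto simp: layout_def fun_eq_iff split: index.splits)
  then have "run (transfer2 Tmp (Reg x) (Aux d)) (?\<sigma>, v) (8 * length ?s + 1)
      (layout \<omega> (A(d := ?s)), v)"
    using run_transfer2[of Tmp "Reg x" "Aux d" ?\<sigma> v] SFor.prems(5) by simp
  ultimately have "run (comp_stm d (SFor x P Ps)) (layout \<omega> A, v)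
      (Suc (5 * length ?s + 1 + Suc (8 * length ?s + 1 + t))) (layout \<omega>' A, v)"
    using t(2) by (simp only: comp_stm.simps list.map) (intro run_Seq)
  then have "run (comp_stm d (SFor x P Ps)) (layout \<omega> A, v)
      (13 * length ?s + 4 + t) (layout \<omega>' A, v)"
    by (rule back_subst[of "\<lambda>t. run _ _ t _"]) simp
  moreover have "13 * length ?s + 4 + t \<le> poly (cost_stm (SFor x P Ps)) L"
  proof -
    have "13 * length ?s + 4 + t \<le> 5 + 13 * length ?s + length ?s * (3 + length (P # Ps) + ?b)"
      using t(1) by simp
    \<comment> \<open>As a leader, \<open>x\<close> itself belongs to \<open>Y\<close>, hence
      \<open>length ?s \<le> L\<close>.\<close>
    also have "\<dots> \<le> 5 + 13 * L + L * (3 + length (P # Ps) + ?b)"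
      using SFor.prems(2,4) by (intro add_mono mult_le_mono) auto
    also have "\<dots> = poly (cost_stm (SFor x P Ps)) L"
      by (simp add: algebra_simps)
    finally show ?thesis .
  qed
  ultimately show ?case by blast
next
  case (SRof x P Ps)
  let ?s = "fst \<omega> x"
  let ?b = "poly (sum_list (map cost_stm (P # Ps))) L"
  have body: "\<exists>t\<le>poly (cost_stm Q) L. run (comp_stm (Suc d) Q) (layout \<omega> A, v) t (layout \<omega>' A, v)"
    if "Q \<in> set (P # Ps)" "Y \<inter> writes_stm Q = {}" "iteration_leaders Q \<subseteq> Y" "exec_stm Q \<omega> \<omega>'"
      "\<forall>x\<in>Y. length (fst \<omega> x) \<le> L" "\<forall>e\<ge>Suc d. A e = []" for Q \<omega> \<omega>' A
    using SRof.IH(1)[of \<omega> \<omega>' "Suc d" A] SRof.IH(2)[of Q \<omega> \<omega>' "Suc d" A] that by auto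
  have bodies: "\<forall>Q\<in>set (P # Ps). Y \<inter> writes_stm Q = {} \<and> iteration_leaders Q \<subseteq> Y"
    using SRof.prems(1,2) by auto
  have iter: "exec_iter (P # Ps) (rev ?s) \<omega> \<omega>'"
    using SRof.prems(3) by (rule exec_SRofE)
  have "\<exists>t\<le>1 + length (rev ?s) * (3 + length (P # Ps) + ?b). run (comp_loop d (map (comp_stm (Suc d)) (P # Ps)))
      (layout \<omega> (A(d := (rev ?s))), v) t (layout \<omega>' A, v)"
    by (rule run_comp_loop[OF body bodies _ iter SRof.prems(4,5)]) simp_all
  then obtain t where t: "t \<le> 1 + length ?s * (3 + length (P # Ps) + ?b)"
    "run (comp_loop d (map (comp_stm (Suc d)) (P # Ps))) (layout \<omega> (A(d := (rev ?s))), v) t (layout \<omega>' A, v)"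
    unfolding length_rev by blast
  \<comment> \<open>\<open>Aux d\<close> is filled in the first pass already, so it keeps the
    reversed order that \<open>SRof\<close> requires.\<close>
  let ?\<sigma> = "(layout \<omega> A)(Reg x := [], Tmp := rev ?s, Aux d := rev ?s)"
  have "run (transfer2 (Reg x) Tmp (Aux d)) (layout \<omega> A, v) (8 * length ?s + 1) (?\<sigma>, v)"
    using run_transfer2[of "Reg x" Tmp "Aux d" "layout \<omega> A" v] SRof.prems(5) by simp
  moreover have "?\<sigma>(Tmp := [], Reg x := ?s) = layout \<omega> (A(d := rev ?s))"
    by (auto simp: layout_def fun_eq_iff split: index.splits)
  then have "run (transfer Tmp (Reg x)) (?\<sigma>, v) (5 * length ?s + 1)
      (layout \<omega> (A(d := rev ?s)), v)"
    using run_transfer[of Tmp "Reg x" ?\<sigma> v] by simp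
  ultimately have "run (comp_stm d (SRof x P Ps)) (layout \<omega> A, v)
      (Suc (8 * length ?s + 1 + Suc (5 * length ?s + 1 + t))) (layout \<omega>' A, v)"
    using t(2) by (simp only: comp_stm.simps list.map) (intro run_Seq)
  then have "run (comp_stm d (SRof x P Ps)) (layout \<omega> A, v)
      (13 * length ?s + 4 + t) (layout \<omega>' A, v)"
    by (rule back_subst[of "\<lambda>t. run _ _ t _"]) simp
  moreover have "13 * length ?s + 4 + t \<le> poly (cost_stm (SRof x P Ps)) L"
  proof -
    have "13 * length ?s + 4 + t \<le> 5 + 13 * length ?s + length ?s * (3 + length (P # Ps) + ?b)"
      using t(1) by simp
    also have "\<dots> \<le> 5 + 13 * L + L * (3 + length (P # Ps) + ?b)"
      using SRof.prems(2,4) by (intro add_mono mult_le_mono) auto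
    also have "\<dots> = poly (cost_stm (SRof x P Ps)) L"
      by (simp add: algebra_simps)
    finally show ?thesis .
  qed
  ultimately show ?case by blast
qed

section \<open>Polynomial running time of whole terms\<close>

fun comp_trm :: "'r trm \<Rightarrow> 'r index com" where
  "comp_trm (TAtom a) = comp_atom a"
| "comp_trm (TSeq P Q) = CSeq (comp_trm P) (comp_trm Q)"
| "comp_trm (TIf x n P) = CIf (Reg x) n (comp_trm P) CNop"
| "comp_trm (Normal y ys S) = comp_stm 0 S"

text \<open>
  Running \<open>P\<close> takes at most \<open>cost_trm P\<close> steps, so it lengthens each stack by at most that much.
\<close>

fun cost_trm :: "'r trm \<Rightarrow> nat poly" where
  "cost_trm (TAtom a) = [:4:]"
| "cost_trm (TSeq P Q) = cost_trm P + pcompose (cost_trm Q) ([:0, 1:] + cost_trm P) + 1"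
| "cost_trm (TIf x n P) = cost_trm P + [:2:]"
| "cost_trm (Normal y ys S) = cost_stm S"

lemma poly_nat_mono: "x \<le> y \<Longrightarrow> poly p x \<le> poly p y" for p :: "nat poly"
  by (induction p) (auto intro!: add_mono mult_mono)

inductive_cases exec_TAtomE: "exec (TAtom a) \<omega> \<omega>'"
inductive_cases exec_TSeqE: "exec (TSeq P Q) \<omega> \<omega>'"
inductive_cases exec_TIfE: "exec (TIf x n P) \<omega> \<omega>'"
inductive_cases exec_NormalE: "exec (Normal y ys S) \<omega> \<omega>'"

text \<open>Any register may grow in one block and lead a loop in a later one. Hence
  \<open>L\<close> bounds all stacks here, and it is enlarged by the running time of
  \<open>P\<close> before \<open>Q\<close> is treated.\<close>

lemma run_comp_trm:
  assumes "normals_ok T" "exec T \<omega> \<omega>'" "\<forall>x. length (fst \<omega> x) \<le> L"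
  shows "\<exists>t\<le>poly (cost_trm T) L.
    run (comp_trm T) (layout \<omega> (\<lambda>_. []), v) t (layout \<omega>' (\<lambda>_. []), v)"
  using assms
proof (induction T arbitrary: \<omega> \<omega>' L)
  case (TAtom a)
  then show ?case
    using run_comp_atom[of a \<omega> "\<lambda>_. []" v] by (auto elim: exec_TAtomE)
next
  case (TSeq P Q)
  obtain \<omega>1 where \<omega>1: "exec P \<omega> \<omega>1" "exec Q \<omega>1 \<omega>'"
    using TSeq.prems(2) by (rule exec_TSeqE)
  obtain t where t: "t \<le> poly (cost_trm P) L"
    "run (comp_trm P) (layout \<omega> (\<lambda>_. []), v) t (layout \<omega>1 (\<lambda>_. []), v)"
    using TSeq.IH(1)[OF _ \<omega>1(1)] TSeq.prems by auto
  have "length (fst \<omega>1 x) \<le> L + t" for x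
    using run_length_le[OF t(2), of "Reg x"] TSeq.prems(3) by (auto intro: le_trans)
  then obtain u where u: "u \<le> poly (cost_trm Q) (L + t)"
    "run (comp_trm Q) (layout \<omega>1 (\<lambda>_. []), v) u (layout \<omega>' (\<lambda>_. []), v)"
    using TSeq.IH(2)[OF _ \<omega>1(2), of "L + t"] TSeq.prems by auto
  have "poly (cost_trm Q) (L + t) \<le> poly (cost_trm Q) (L + poly (cost_trm P) L)"
    using t(1) by (intro poly_nat_mono) simp
  then show ?case
    using run_Seq[OF t(2) u(2)] t(1) u(1)
    by (auto simp: poly_pcompose intro!: exI[of _ "Suc (t + u)"])
next
  case (TIf x n P)
  let ?\<sigma> = "\<lambda>\<omega>. (layout \<omega> (\<lambda>_. []), v)"
  show ?case
  proof (cases "top_is n (fst \<omega> x)")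
    case True
    then have "exec P \<omega> \<omega>'"
      using TIf.prems(2) by (auto elim: exec_TIfE)
    then obtain t where t: "t \<le> poly (cost_trm P) L" "run (comp_trm P) (?\<sigma> \<omega>) t (?\<sigma> \<omega>')"
      using TIf.IH[of \<omega> \<omega>' L] TIf.prems by auto
    have "run (comp_trm (TIf x n P)) (?\<sigma> \<omega>) (Suc t) (?\<sigma> \<omega>')"
      using t(2) True by (auto intro: run_If_true)
    then show ?thesis
      using t(1) by (auto intro!: exI[of _ "Suc t"])
  next
    case False
    then have "\<omega>' = \<omega>"
      using TIf.prems(2) by (auto elim: exec_TIfE)
    then have "run (comp_trm (TIf x n P)) (?\<sigma> \<omega>) (Suc (Suc 0)) (?\<sigma> \<omega>')"
      using False by (auto intro: run_If_false run_Nop)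
    then show ?thesis
      by (auto intro!: exI[of _ "Suc (Suc 0)"])
  qed
next
  case (Normal y ys S)
  have "exec_stm S \<omega> \<omega>'"
    using Normal.prems(2) by (rule exec_NormalE)
  \<comment> \<open>The registers listed in the block serve as \<open>Y\<close>: by
    \<open>normals_ok\<close> they are unwritten and include all loop leaders.\<close>
  then show ?case
    using run_comp_stm[of "set (y # ys)" S \<omega> \<omega>' L 0 "\<lambda>_. []" v] Normal.prems by auto
qed

lemma copies_proper_dispatch:
  "(\<And>c. c \<in> set cs \<Longrightarrow> copies_proper c) \<Longrightarrow> copies_proper (dispatch k n cs)"
  by (induction k n cs rule: dispatch.induct) auto

lemma copies_proper_comp_atom: "copies_proper (comp_atom a)"
  by (cases a) auto

lemma copies_proper_comp_stm: "copies_proper (comp_stm d S)"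
  by (induction S arbitrary: d)
    (auto simp: copies_proper_comp_atom transfer_def transfer2_def comp_loop_def
      intro!: copies_proper_dispatch)

lemma copies_proper_comp_trm: "copies_proper (comp_trm T)"
  by (induction T) (auto simp: copies_proper_comp_atom copies_proper_comp_stm)

section \<open>Output and membership in FPTIME\<close>

definition emit_all :: "'k \<Rightarrow> 'k com" where
  "emit_all k = CWhile k (CSeq (CEmit k) (CPop k))"

text \<open>A round takes 4 steps: loop test, sequencing, emission and pop. The top is emitted
  first, which is the order in which words are encoded.\<close>

lemma run_emit_all: "run (emit_all k) (\<sigma>, v) (4 * length (\<sigma> k) + 1) (\<sigma>(k := []), v @ \<sigma> k)"
  unfolding emit_all_def
proof (induction "\<sigma> k" arbitrary: \<sigma> v)
  case Nil
  then have "\<sigma>(k := []) = \<sigma>"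
    by (simp add: fun_upd_idem)
  then show ?case
    using Nil run_While_false[of "(\<sigma>, v)" k] by (simp del: fun_upd_apply)
next
  case (Cons n s)
  note \<sigma>k = Cons.hyps(2)[symmetric]
  let ?w = "CWhile k (CSeq (CEmit k) (CPop k))"
  let ?\<sigma>' = "\<sigma>(k := tl (\<sigma> k))"
  have "run (CSeq (CEmit k) (CPop k)) (\<sigma>, v) (Suc (Suc 0 + Suc 0)) (?\<sigma>', v @ [n])"
    by (rule run_Seq[OF run_Emit run_Pop]) (rule \<sigma>k)
  moreover have "run ?w (?\<sigma>', v @ [n]) (4 * length s + 1) (\<sigma>(k := []), v @ n # s)"
    using Cons.hyps(1)[of ?\<sigma>' "v @ [n]"] by (simp add: \<sigma>k)
  ultimately have "run ?w (\<sigma>, v) (Suc (Suc (Suc 0 + Suc 0) + (4 * length s + 1)))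
      (\<sigma>(k := []), v @ n # s)"
    using \<sigma>k by (intro run_While_true) (simp_all del: fun_upd_apply)
  then show ?case
    by (simp add: \<sigma>k eval_nat_numeral del: fun_upd_apply)
qed

theorem theorem3:
  fixes T :: "'r::countable trm" and \<Sigma> :: "'a set" and f :: "'a list \<Rightarrow> 'a list"
  assumes "finite \<Sigma>"
    and "f \<in> lists \<Sigma> \<rightarrow> lists \<Sigma>"
    and "T \<in> ForNo"
    and "\<exists>rin rout enc. encoding \<Sigma> enc \<and> computes T rin rout \<Sigma> enc f"
  shows "f \<in> FPTIME \<Sigma>"
proof -
  obtain rin rout enc where enc: "encoding \<Sigma> enc" and comp: "computes T rin rout \<Sigma> enc f"
    using assms(4) by blast
  \<comment> \<open>Decoding the numbers below \<open>card \<Sigma>\<close> makes the input word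
    itself an encoded stack; marks for all other numbers keep \<open>h\<close> injective.\<close>
  define h :: "nat \<Rightarrow> 'a symbol"
    where "h n = (if n < card \<Sigma> then Letter (inv_into \<Sigma> enc n) else Mark n)" for n
  \<comment> \<open>The input register must sit on tape 0, where \<open>tm_init\<close> writes the
    word; \<open>Suc\<close> keeps all other stacks off that tape.\<close>
  define ix :: "'r index \<Rightarrow> nat"
    where "ix k = (if k = Reg rin then 0 else Suc (to_nat k))" for k
  define c where "c = CSeq (comp_trm T) (emit_all (Reg rout))"
  \<comment> \<open>Inserting 0 ensures that the input tape differs from the output tape
    \<open>N\<close> even if the program never uses \<open>rin\<close>.\<close>
  obtain N where N: "\<forall>i\<in>insert 0 (ix ` indices c). i < N"
    using finite_indices[of c] finite_nat_set_iff_bounded by (metis finite_imageI finite_insert)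
  have bij: "bij_betw enc \<Sigma> {..<card \<Sigma>}"
    using enc by (simp add: encoding_def)
  have inj_inv: "inj_on (inv_into \<Sigma> enc) {..<card \<Sigma>}"
    using bij by (metis bij_betw_def inj_on_inv_into subset_refl)
  interpret stack_tm N ix h
  proof
    show "inj ix"
      by (auto simp: inj_def ix_def)
    show "inj h"
      using inj_onD[OF inj_inv] by (auto simp: inj_def h_def)
    show "h n \<noteq> Blank" for n
      by (simp add: h_def)
  qed
  have h_enc: "h (enc a) = Letter a" if "a \<in> \<Sigma>" for a
    using that bij by (auto simp: h_def bij_betw_def inv_into_f_f)
  define M where "M = machine \<Sigma> c"
  \<comment> \<open>The total time is \<open>t + 4 * length (f w) + 2\<close>, and
    \<open>length (f w) \<le> length w + t\<close> turns this into at most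
    \<open>2 + 4 * length w + 5 * t\<close>.\<close>
  define p :: "nat poly" where "p = [:2, 4:] + smult 5 (cost_trm T)"
  have "turing_machine \<Sigma> M"
    unfolding M_def using N assms(1) by (intro turing_machine_machine) auto
  moreover have "tm_outputs_within M w (poly p (length w)) (f w)" if w: "w \<in> lists \<Sigma>" for w
  proof -
    let ?\<omega> = "(empty_store(rin := map enc w), 0)"
    obtain \<phi> where \<phi>: "exec T ?\<omega> (\<phi>, 0)" "\<phi> rout = map enc (f w)"
      using comp w by (auto simp: computes_def)
    let ?\<sigma> = "layout ?\<omega> (\<lambda>_. [])"
    let ?\<sigma>' = "layout (\<phi>, 0) (\<lambda>_. [])"
    have "\<forall>x. length (fst ?\<omega> x) \<le> length w"
      by (simp add: empty_store_def)
    then obtain t where t: "t \<le> poly (cost_trm T) (length w)" "run (comp_trm T) (?\<sigma>, []) t (?\<sigma>', [])"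
      using run_comp_trm[OF _ \<phi>(1), of "length w" "[]"] assms(3) unfolding ForNo_def by blast
    define u where "u = Suc (t + (4 * length (f w) + 1))"
    have "run c (?\<sigma>, []) u (?\<sigma>'(Reg rout := []), map enc (f w))"
      unfolding c_def u_def
      using run_Seq[OF t(2) run_emit_all[of "Reg rout" ?\<sigma>' "[]"]] \<phi>(2) by simp
    moreover obtain ts where ts: "tm_init M w = (to_nat [c], ts)" "represents (?\<sigma>, []) ts"
    proof
      let ?ts = "(word_on_tape w, 0) # replicate N (word_on_tape [], 0)"
      show "tm_init M w = (to_nat [c], ?ts)"
        by (simp add: tm_init_def M_def machine_def)
      have "(word_on_tape w, 0) = stack_tape (map enc w) 0"
        using w by (auto simp: stack_tape_def word_on_tape_def fun_eq_iff in_lists_conv_set h_enc)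
      moreover have "(word_on_tape [], 0) = stack_tape [] 0" "(word_on_tape [], 0) = output_tape []"
        by (auto simp: stack_tape_def output_tape_def word_on_tape_def fun_eq_iff)
      moreover have "?\<sigma> k = []" if "k \<noteq> Reg rin" for k
        using that by (cases k) (auto simp: empty_store_def)
      ultimately show "represents (?\<sigma>, []) ?ts"
        using N by (auto simp: represents_def ix_def nth_Cons')
    qed
    moreover have "copies_proper c"
      by (simp add: c_def emit_all_def copies_proper_comp_trm)
    moreover have "ix ` indices c \<subseteq> {..<N}"
      using N by auto
    ultimately obtain ts' where ts':
      "(tm_step M ^^ u) (tm_init M w) = (to_nat ([] :: 'r index com list), ts')"
      "represents (?\<sigma>'(Reg rout := []), map enc (f w)) ts'"
      unfolding M_def using machine_run[of c "(?\<sigma>, [])" u _ ts \<Sigma> c "[]"] by metis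
    have "last ts' = output_tape (map enc (f w))"
      using ts'(2) by (cases ts' rule: rev_cases) (auto simp: represents_def nth_append)
    moreover have "f w \<in> lists \<Sigma>"
      using assms(2) w by blast
    ultimately have "fst (last ts') = word_on_tape (f w)"
      by (auto simp: output_tape_def word_on_tape_def fun_eq_iff in_lists_conv_set h_enc)
    \<comment> \<open>Initially \<open>rout\<close> is empty or, if it coincides with
      \<open>rin\<close>, holds the encoded input.\<close>
    moreover have "length (f w) \<le> length w + t"
      using run_length_le[OF t(2), of "Reg rout"] \<phi>(2)
      by (auto simp: empty_store_def split: if_splits)
    then have "u \<le> poly p (length w)"
      using t(1) by (simp add: u_def p_def)
    ultimately show ?thesis
      unfolding tm_outputs_within_def using ts'(1)
      by (intro exI[of _ u]) (auto simp: M_def machine_def)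
  qed
  ultimately show ?thesis
    using assms(2) unfolding FPTIME_def by blast
qed

end
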